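(* Let $n\ge1$ and $N>0$. Among all $\bm r\in\mathbb R^n$ with $r_j\ge0$ for all $j$ and $\sum_{j=1}^n\sinh^2r_j=N$, the cost $$C_{\mathrm{phase}}(\bm r)=\sum_{j=1}^n\frac1{2\sinh^2(2r_j)}$$ is uniquely minimized by uniform squeezing, i.e. by $r_1=\cdots=r_n$.
   Context: $C_{\mathrm{phase}}(\bm r)$ is the trace of the inverse of the local-phase Fisher matrix $\mathrm{diag}(2\sinh^2(2r_1),\dots,2\sinh^2(2r_n))$ of $n$ independent single-mode squeezed vacua with squeezing parameters $r_j$; it takes the value $+\infty$ if some $r_j=0$. The mean photon number is $\sum_j\sinh^2r_j$. *)

theory Defs
  imports "HOL-Analysis.Analysis"
begin

definition phase_fisher :: "real ^ 'n \<Rightarrow> real ^ 'n ^ 'n::finite" where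
  "phase_fisher r = (\<chi> i j. if i = j then 2 * (sinh (2 * r $ i))\<^sup>2 else 0)"

text \<open>The vanishing of some \<open>r $ j\<close> is exactly singularity of the Fisher matrix; the
  case distinction is needed because \<^const>\<open>matrix_inv\<close> is unspecified there.\<close>

definition C_phase :: "real ^ 'n::finite \<Rightarrow> ereal" where
  "C_phase r = (if \<exists>j. r $ j = 0 then \<infinity> else ereal (trace (matrix_inv (phase_fisher r))))"

definition mean_photon_number :: "real ^ 'n::finite \<Rightarrow> real" where
  "mean_photon_number r = (\<Sum>j\<in>UNIV. (sinh (r $ j))\<^sup>2)"

definition feasible :: "real \<Rightarrow> real ^ 'n::finite \<Rightarrow> bool" where
  "feasible N r \<longleftrightarrow> (\<forall>j. r $ j \<ge> 0) \<and> mean_photon_number r = N"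

lemma matrix_inv_phase_fisher:
  fixes r :: "real ^ 'n::finite"
  assumes "\<And>j. r $ j \<noteq> 0"
  shows "matrix_inv (phase_fisher r) =
    (\<chi> i j. if i = j then 1 / (2 * (sinh (2 * r $ i))\<^sup>2) else 0)" (is "_ = ?B")
proof -
  have prod: "(phase_fisher r ** ?B) $ i $ j = mat 1 $ i $ j" for i j
  proof -
    have "(phase_fisher r ** ?B) $ i $ j =
      (\<Sum>k\<in>UNIV. if k = i then 2 * (sinh (2 * r $ i))\<^sup>2 * ?B $ i $ j else 0)"
      unfolding matrix_matrix_mult_def phase_fisher_def
      by (simp only: vec_lambda_beta, rule sum.cong) auto
    also have "\<dots> = 2 * (sinh (2 * r $ i))\<^sup>2 * ?B $ i $ j"
      by (simp only: sum.delta finite_UNIV finite if_True UNIV_I)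
    also have "\<dots> = mat 1 $ i $ j"
      using assms[of i] by (auto simp: mat_def)
    finally show ?thesis .
  qed
  have 1: "phase_fisher r ** ?B = mat 1"
    unfolding vec_eq_iff using prod by blast
  show ?thesis
    unfolding matrix_inv_def
  proof (rule some_equality)
    show "phase_fisher r ** ?B = mat 1 \<and> ?B ** phase_fisher r = mat 1"
      using 1 matrix_left_right_inverse by blast
    show "A = ?B" if "phase_fisher r ** A = mat 1 \<and> A ** phase_fisher r = mat 1" for A
    proof -
      have "A = A ** (phase_fisher r ** ?B)"
        by (simp only: 1 matrix_mul_rid)
      also have "\<dots> = ?B"
        by (simp only: matrix_mul_assoc that matrix_mul_lid)
      finally show ?thesis .
    qed
  qed
qed

text \<open>In \<^typ>\<open>ereal\<close> one has \<open>1 / 0 = \<infinity>\<close>, so the sum formula below covers the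
  case of a vanishing \<open>r $ j\<close> as well.\<close>

lemma C_phase_eq_sum:
  fixes r :: "real ^ 'n::finite"
  shows "C_phase r = (\<Sum>j\<in>UNIV. 1 / ereal (2 * (sinh (2 * r $ j))\<^sup>2))"
proof (cases "\<exists>j. r $ j = 0")
  case True
  then obtain j where "r $ j = 0" by blast
  then have "1 / ereal (2 * (sinh (2 * r $ j))\<^sup>2) = \<infinity>"
    by (simp add: divide_ereal_def)
  moreover have "1 / ereal (2 * (sinh (2 * r $ i))\<^sup>2) \<noteq> -\<infinity>" for i
    by (simp add: divide_ereal_def)
  ultimately have "(\<Sum>j\<in>UNIV. 1 / ereal (2 * (sinh (2 * r $ j))\<^sup>2)) = \<infinity>"
    by (subst sum_Pinfty) auto
  with True show ?thesis by (simp add: C_phase_def)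
next
  case False
  then show ?thesis
    by (simp add: C_phase_def matrix_inv_phase_fisher trace_def divide_ereal_def
        inverse_eq_divide)
qed

end

theory Submission
  imports Defs
begin

text \<open>In the photon numbers \<open>x\<^sub>j = sinh\<^sup>2 r\<^sub>j\<close> the constraint is linear, and
  \<open>sinh\<^sup>2 (2r) = 4x(1 + x)\<close> turns the cost into the sum of the values of the strictly convex
  function \<open>x \<mapsto> 1 / (8x(1 + x))\<close>. Adding up its tangent line inequalities at the mean
  \<open>m = N / n\<close> makes the linear terms cancel.\<close>

lemma sinh_double_power2: "(sinh (2 * x :: real))\<^sup>2 = 4 * (sinh x)\<^sup>2 * (1 + (sinh x)\<^sup>2)"
  by (simp add: sinh_double power_mult_distrib cosh_square_eq add.commute)

text \<open>The slope is the derivative \<open>- (1 + 2 * m) / (m * (1 + m))\<^sup>2\<close> of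
  \<open>1 / (x * (1 + x))\<close> at \<open>m\<close>. The gap between function and tangent is
  computed exactly: it has a double root at \<open>m\<close>, and the cofactor of
  \<open>(x - m)\<^sup>2\<close> is positive for positive \<open>x\<close> and
  \<open>m\<close>.\<close>

lemma inverse_quadratic_above_tangent:
  fixes x m :: real
  assumes "x > 0" "m > 0" "x \<noteq> m"
  shows "1 / (m * (1 + m)) - (1 + 2 * m) / (m * (1 + m))\<^sup>2 * (x - m) < 1 / (x * (1 + x))"
proof -
  have "1 / (x * (1 + x)) - (1 / (m * (1 + m)) - (1 + 2 * m) / (m * (1 + m))\<^sup>2 * (x - m))
      = (x - m)\<^sup>2 * (1 + x + 2 * m + 2 * m * x + m\<^sup>2) / (x * (1 + x) * (m * (1 + m))\<^sup>2)"
  proof -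
    have "x \<noteq> 0" "1 + x \<noteq> 0" "m \<noteq> 0" "1 + m \<noteq> 0"
      using assms by auto
    then show ?thesis
      by (simp add: divide_simps power2_eq_square) algebra
  qed
  moreover have "\<dots> > 0"
    using assms by (intro divide_pos_pos mult_pos_pos add_pos_pos) auto
  ultimately show ?thesis by simp
qed

lemma inverse_quadratic_sum_strict_min:
  fixes x :: "'a \<Rightarrow> real" and m :: real
  assumes "finite A" and pos: "\<And>i. i \<in> A \<Longrightarrow> x i > 0" and "m > 0"
    and sum: "sum x A = card A * m" and "k \<in> A" "x k \<noteq> m"
  shows "card A * (1 / (m * (1 + m))) < (\<Sum>i\<in>A. 1 / (x i * (1 + x i)))"
proof -
  let ?c = "(1 + 2 * m) / (m * (1 + m))\<^sup>2"
  have "(\<Sum>i\<in>A. ?c * (x i - m)) = 0"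
    by (simp only: sum_distrib_left [symmetric] sum_subtractf sum) simp
  then have "card A * (1 / (m * (1 + m))) = (\<Sum>i\<in>A. 1 / (m * (1 + m)) - ?c * (x i - m))"
    by (simp add: sum_subtractf)
  \<comment> \<open>Indices with \<open>x i = m\<close> give only equality; the single index
    \<open>k\<close> off the mean makes the whole sum strict.\<close>
  also have "\<dots> < (\<Sum>i\<in>A. 1 / (x i * (1 + x i)))"
  proof (rule sum_strict_mono_ex1)
    show "\<forall>i\<in>A. 1 / (m * (1 + m)) - ?c * (x i - m) \<le> 1 / (x i * (1 + x i))"
    proof
      fix i assume "i \<in> A"
      then show "1 / (m * (1 + m)) - ?c * (x i - m) \<le> 1 / (x i * (1 + x i))"
        using inverse_quadratic_above_tangent [of "x i" m] pos \<open>m > 0\<close>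
        by (cases "x i = m") (auto intro: less_imp_le)
    qed
    show "\<exists>i\<in>A. 1 / (m * (1 + m)) - ?c * (x i - m) < 1 / (x i * (1 + x i))"
      using inverse_quadratic_above_tangent [of "x k" m] pos \<open>m > 0\<close> \<open>k \<in> A\<close> \<open>x k \<noteq> m\<close> by blast
  qed fact
  finally show ?thesis .
qed

text \<open>The 8 is the factor 2 of the Fisher matrix times the 4 of the doubling formula.
  Vanishing components are excluded because there the real quotient is 0 while the cost is
  infinite.\<close>

lemma C_phase_eq_photon_sum:
  fixes r :: "real ^ 'n::finite"
  assumes "\<And>j. r $ j \<noteq> 0"
  shows "C_phase r = ereal ((\<Sum>j\<in>UNIV. 1 / ((sinh (r $ j))\<^sup>2 * (1 + (sinh (r $ j))\<^sup>2))) / 8)"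
proof -
  have "C_phase r = ereal (\<Sum>j\<in>UNIV. 1 / (2 * (sinh (2 * r $ j))\<^sup>2))"
    using assms by (simp add: C_phase_def matrix_inv_phase_fisher trace_def)
  also have "\<dots> = ereal ((\<Sum>j\<in>UNIV. 1 / ((sinh (r $ j))\<^sup>2 * (1 + (sinh (r $ j))\<^sup>2))) / 8)"
    unfolding sinh_double_power2 by (simp add: sum_divide_distrib mult_ac)
  finally show ?thesis .
qed

lemma arsinh_real_nonneg_iff [simp]: "arsinh x \<ge> 0 \<longleftrightarrow> x \<ge> (0 :: real)"
  using arsinh_real_neg_iff [of x] by linarith

text \<open>On the nonnegative half-line the photon number determines the squeezing, so (in)equality
  of photon numbers carries over to squeezing parameters.\<close>

lemma sinh_power2_eq_iff:
  fixes x m :: real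
  assumes "x \<ge> 0" "m \<ge> 0"
  shows "(sinh x)\<^sup>2 = m \<longleftrightarrow> x = arsinh (sqrt m)"
proof
  assume "(sinh x)\<^sup>2 = m"
  then have "sqrt m = sinh x" using assms by auto
  then show "x = arsinh (sqrt m)" by (simp add: arsinh_sinh_real)
qed (use assms in simp)

definition uniform_squeezing :: "real \<Rightarrow> real ^ 'n::finite" where
  "uniform_squeezing N = (\<chi> i. arsinh (sqrt (N / CARD('n))))"

lemma feasible_uniform_squeezing:
  assumes "N \<ge> 0"
  shows "feasible N (uniform_squeezing N :: real ^ 'n::finite)"
  using assms by (simp add: feasible_def mean_photon_number_def uniform_squeezing_def)

text \<open>Equal components split \<open>N\<close> evenly over the modes, which fixes each of them.
  Both claims of the theorem thus reduce to statements about one explicit vector.\<close>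

lemma feasible_constant_iff:
  fixes r :: "real ^ 'n::finite"
  assumes "N \<ge> 0"
  shows "feasible N r \<and> (\<forall>i j. r $ i = r $ j) \<longleftrightarrow> r = uniform_squeezing N"
proof
  assume r: "feasible N r \<and> (\<forall>i j. r $ i = r $ j)"
  have "r $ i = arsinh (sqrt (N / CARD('n)))" for i
  proof -
    have "mean_photon_number r = (\<Sum>j\<in>(UNIV :: 'n set). (sinh (r $ i))\<^sup>2)"
      unfolding mean_photon_number_def using r by (metis (no_types))
    then have "(sinh (r $ i))\<^sup>2 = N / CARD('n)"
      using r by (simp add: feasible_def field_simps)
    then show ?thesis
      using r assms by (simp add: feasible_def sinh_power2_eq_iff)
  qed
  then show "r = uniform_squeezing N"
    by (simp add: vec_eq_iff uniform_squeezing_def)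
next
  assume "r = uniform_squeezing N"
  then show "feasible N r \<and> (\<forall>i j. r $ i = r $ j)"
    using feasible_uniform_squeezing [OF assms] by (simp add: uniform_squeezing_def)
qed

lemma C_phase_uniform_squeezing_less:
  fixes r :: "real ^ 'n::finite"
  assumes "N > 0" and r: "feasible N r" and ne: "r \<noteq> uniform_squeezing N"
  shows "C_phase (uniform_squeezing N :: real ^ 'n) < C_phase r"
proof -
  define m where "m = N / CARD('n)"
  have m: "m > 0" using \<open>N > 0\<close> by (simp add: m_def)
  have u: "C_phase (uniform_squeezing N :: real ^ 'n)
      = ereal (CARD('n) * (1 / (m * (1 + m))) / 8)"
    using m by (subst C_phase_eq_photon_sum)
      (auto simp: uniform_squeezing_def simp flip: m_def)
  show ?thesis
  proof (cases "\<exists>j. r $ j = 0")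
    \<comment> \<open>A mode in the vacuum makes the cost infinite, whereas \<open>u\<close> shows
      that the uniform cost is finite.\<close>
    case True
    then show ?thesis using u by (simp add: C_phase_def)
  next
    case False
    obtain k where "r $ k \<noteq> arsinh (sqrt m)"
      using ne by (auto simp: vec_eq_iff uniform_squeezing_def m_def)
    then have "(sinh (r $ k))\<^sup>2 \<noteq> m"
      using r m by (simp add: feasible_def sinh_power2_eq_iff)
    then have "CARD('n) * (1 / (m * (1 + m)))
        < (\<Sum>j\<in>UNIV. 1 / ((sinh (r $ j))\<^sup>2 * (1 + (sinh (r $ j))\<^sup>2)))"
      using False r m
      by (intro inverse_quadratic_sum_strict_min [where k = k])
        (auto simp: feasible_def mean_photon_number_def m_def)
    then show ?thesis
      using False by (simp add: u C_phase_eq_photon_sum)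
  qed
qed

theorem propositionS27:
  fixes N :: real
  assumes "N > 0"
  shows "(\<exists>!r :: real ^ 'n::finite. is_arg_min C_phase (feasible N) r) \<and>
    (\<forall>r :: real ^ 'n. is_arg_min C_phase (feasible N) r \<longleftrightarrow>
      feasible N r \<and> (\<forall>i j. r $ i = r $ j))"
proof -
  \<comment> \<open>Any other feasible point is strictly beaten by the uniform one, hence is no
    minimizer; by asymmetry of the order none of them beats the uniform one.\<close>
  have "is_arg_min C_phase (feasible N) r \<longleftrightarrow> r = uniform_squeezing N" for r :: "real ^ 'n"
    unfolding is_arg_min_def
    using C_phase_uniform_squeezing_less [OF assms] feasible_uniform_squeezing [of N] assms
    by (metis less_asym less_imp_le order_less_irrefl)
  then show ?thesis
    using assms by (simp add: feasible_constant_iff)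
qed

end
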